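(* Let $(\Phi,\mathbb P)$ be a simple stationary point process on $\mathbb R^d$ with non-degenerate intensity and let $f$ be a point-map. If $(\Phi,\mathbb P)$ evaporates under the action of $f$, and if the $f$-probability $\mathcal P_0^f$ of $\mathcal P_0=\Phi_*\mathbb P_\Phi$ exists and satisfies $\mathcal P_0^f=(\theta_f)_*\mathcal P_0^f$, then $\mathcal P_0^f$ is singular with respect to $\mathcal P_0$.
   Context: $\mathbf N$ is the space of locally finite counting measures on $\mathbb R^d$ (not necessarily simple; identified with multisets), with the vague topology and its Borel $\sigma$-field $\mathcal N$. $\overline\phi$ is the support of $\phi$; $x\in\phi$ means $\phi(\{x\})>0$. $\mathbf N^0=\{\phi\in\mathbf N:0\in\phi\}$. For $t\in\mathbb R^d$, $\theta_t\phi(B)=\phi(B+t)$ (translation by $-t$). $\mathbf M^1(\mathbf N^0)$ is the set of probability measures on $\mathbf N^0$ with the topology of weak convergence. Point-map: a measurable $f:\mathbf N^0\to\mathbb R^d$ with $f(\phi)=f(\overline\phi)\in\overline\phi$ for all $\phi$. Its point-shift is $F(\phi,x)=f(\theta_x\phi)+x$ for $x\in\phi$. Iterates: $F^0(\phi,x)=x$, $F^{k+1}(\phi,x)=F(\phi,F^k(\phi,x))$; $F^{-n}(\phi,y)=\{x\in\phi:F^n(\phi,x)=y\}$. For $\phi\in\mathbf N^0$, $\theta_f(\phi)=\theta_{f(\phi)}\phi\in\mathbf N^0$, with $n$-th iterate $\theta_f^n$. Stationary point process: $(\theta_t)_{t\in\mathbb R^d}$ is a measurable flow on a probability space $(\Omega,\mathcal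 F,\mathbb P)$ leaving $\mathbb P$ invariant, and $\Phi:\Omega\to\mathbf N$ is measurable with $\Phi\circ\theta_t=\theta_t\circ\Phi$. Its intensity $\lambda$ is the mean number of points (with multiplicity) in the unit cube; it is non-degenerate if $0<\lambda<\infty$. The Palm probability is $\mathbb P_\Phi[A]=\frac1{\lambda|B|}\int_\Omega\int_B\mathbf 1\{\theta_t\omega\in A\}\,\Phi(\omega,dt)\,\mathbb P[d\omega]$ for any Borel $B$ with Lebesgue measure $0<|B|<\infty$. $\mathcal P_0=\Phi_*\mathbb P_\Phi$ is the Palm distribution, a probability on $\mathbf N^0$. Here $h_*\mu(A)=\mu(h^{-1}A)$. The $f$-probability of $\mathcal P_0$ is $\mathcal P_0^f=\lim_{n\to\infty}(\theta_f^n)_*\mathcal P_0$ in $\mathbf M^1(\mathbf N^0)$, when this limit exists. Evaporation: $(\Phi,\mathbb P)$ evaporates under the action of $f$ if, $\mathbb P$-almost surely, $\bigcap_{n\ge1}\{y\in\Phi:F^{-n}(\Phi,y)\neq\emptyset\}=\emptyset$. *)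

theory Defs
  imports "HOL-Probability.Probability"
begin

section \<open>The space of locally finite counting measures\<close>

text \<open>
  Counting measures are the Borel measures on \<open>\<real>\<^sup>d\<close> (a Euclidean space \<open>'a\<close>) whose value on every
  bounded Borel set is a natural number, so that both multiplicities and local finiteness are
  covered. An unbounded Borel set then has a value in \<open>\<nat> \<union> {\<infinity>}\<close>.
\<close>

typedef (overloaded) 'a counting_measure =
  "{M :: 'a::euclidean_space measure.
      sets M = sets borel \<and> (\<forall>B\<in>sets borel. bounded B \<longrightarrow> emeasure M B \<in> \<nat>)}"
  morphisms as_measure Abs_counting_measure
proof
  show "null_measure borel \<in> {M :: 'a measure.
      sets M = sets borel \<and> (\<forall>B\<in>sets borel. bounded B \<longrightarrow> emeasure M B \<in> \<nat>)}"
    by simp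
qed

setup_lifting type_definition_counting_measure

text \<open>The vague topology: the coarsest one for which integration of every continuous function with
  compact support is continuous. The constant \<open>borel\<close> at type \<open>'a counting_measure\<close> is its Borel
  \<open>\<sigma>\<close>-algebra.\<close>

instantiation counting_measure :: (euclidean_space) topological_space
begin

definition open_counting_measure :: "'a counting_measure set \<Rightarrow> bool" where
  "open_counting_measure = generate_topology
     {{\<phi>. (\<integral>x. g x \<partial>as_measure \<phi>) \<in> V} | (g :: 'a \<Rightarrow> real) V.
        continuous_on UNIV g \<and> compact (closure {x. g x \<noteq> 0}) \<and> open V}"

instance
proof
  show "open (UNIV :: 'a counting_measure set)"
    unfolding open_counting_measure_def by (rule generate_topology.UNIV)
  show "open (S \<inter> T)" if "open S" "open T" for S T :: "'a counting_measure set"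
    using that unfolding open_counting_measure_def by (rule generate_topology.Int)
  show "open (\<Union>K)" if "\<forall>S\<in>K. open S" for K :: "'a counting_measure set set"
    using that unfolding open_counting_measure_def by (intro generate_topology.UN) blast
qed

end

lemma sets_as_measure [simp, measurable_cong]: "sets (as_measure \<phi>) = sets borel"
  using as_measure[of \<phi>] by simp

lemma space_as_measure [simp]: "space (as_measure \<phi>) = UNIV"
  using sets_eq_imp_space_eq[OF sets_as_measure] by simp

lemma as_measure_bounded_Nats:
  "B \<in> sets borel \<Longrightarrow> bounded B \<Longrightarrow> emeasure (as_measure \<phi>) B \<in> \<nat>"
  using as_measure[of \<phi>] by simp

text \<open>\<open>points \<phi>\<close> is the set of \<open>x\<close> with \<open>x \<in> \<phi>\<close>; it is also the support of \<open>\<phi>\<close>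
  (lemma \<open>points_iff_support\<close>).\<close>

definition points :: "'a::euclidean_space counting_measure \<Rightarrow> 'a set" where
  "points \<phi> = {x. emeasure (as_measure \<phi>) {x} > 0}"

lemma Nats_ennreal_ge_1: "(n :: ennreal) \<in> \<nat> \<Longrightarrow> n > 0 \<Longrightarrow> 1 \<le> n"
  by (auto elim!: Nats_cases simp: Suc_le_eq)

lemma Nats_ennreal_finite: "(n :: ennreal) \<in> \<nat> \<Longrightarrow> n < \<infinity>"
  by (auto elim!: Nats_cases simp: of_nat_less_top)

lemma points_iff_support:
  "x \<in> points \<phi> \<longleftrightarrow> (\<forall>U. open U \<longrightarrow> x \<in> U \<longrightarrow> emeasure (as_measure \<phi>) U > 0)"
proof
  assume x: "x \<in> points \<phi>"
  show "\<forall>U. open U \<longrightarrow> x \<in> U \<longrightarrow> emeasure (as_measure \<phi>) U > 0"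
  proof (intro allI impI)
    fix U :: "'a set" assume "open U" "x \<in> U"
    then have "emeasure (as_measure \<phi>) {x} \<le> emeasure (as_measure \<phi>) U"
      by (intro emeasure_mono) auto
    with x show "emeasure (as_measure \<phi>) U > 0"
      unfolding points_def by auto
  qed
next
  assume pos: "\<forall>U. open U \<longrightarrow> x \<in> U \<longrightarrow> emeasure (as_measure \<phi>) U > 0"
  define B where "B n = ball x (1 / Suc n)" for n :: nat
  have bB: "bounded (B n)" "B n \<in> sets borel" for n by (auto simp: B_def)
  have ge1: "1 \<le> emeasure (as_measure \<phi>) (B n)" for n
    using pos bB by (intro Nats_ennreal_ge_1 as_measure_bounded_Nats) (auto simp: B_def)
  have fin: "emeasure (as_measure \<phi>) (B n) \<noteq> \<infinity>" for n
    using Nats_ennreal_finite[OF as_measure_bounded_Nats[OF bB(2,1)], of \<phi> n] by simp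
  have dec: "decseq B"
    by (auto simp: B_def decseq_def subset_ball frac_le intro!: subset_ball)
  have INT: "(\<Inter>n. B n) = {x}"
  proof (intro equalityI subsetI)
    fix y assume y: "y \<in> (\<Inter>n. B n)"
    show "y \<in> {x}"
    proof (rule ccontr)
      assume "y \<notin> {x}"
      then have "dist x y > 0" by auto
      then obtain n where "inverse (of_nat (Suc n)) < dist x y"
        using reals_Archimedean by blast
      moreover have "y \<in> B n" using y by blast
      ultimately show False by (simp add: B_def inverse_eq_divide)
    qed
  qed (auto simp: B_def)
  have "(\<lambda>n. emeasure (as_measure \<phi>) (B n)) \<longlonglongrightarrow> emeasure (as_measure \<phi>) (\<Inter>n. B n)"
    using bB fin dec by (intro Lim_emeasure_decseq) auto
  then have "1 \<le> emeasure (as_measure \<phi>) {x}"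
    unfolding INT by (rule LIMSEQ_le_const) (use ge1 in auto)
  then show "x \<in> points \<phi>"
    unfolding points_def by (auto intro: less_le_trans[OF zero_less_one])
qed

lemma finite_bounded_points: "bounded B \<Longrightarrow> finite (B \<inter> points \<phi>)"
proof (rule ccontr)
  assume bd: "bounded B" and inf: "infinite (B \<inter> points \<phi>)"
  obtain r where r: "B \<subseteq> cball 0 r"
    using bounded_subset_ballD[OF bd, of 0] ball_subset_cball by (metis subset_trans)
  have "emeasure (as_measure \<phi>) (cball 0 r) \<in> \<nat>"
    by (intro as_measure_bounded_Nats) auto
  then obtain n where n: "emeasure (as_measure \<phi>) (cball 0 r) = of_nat n"
    by (rule Nats_cases)
  obtain S where S: "finite S" "card S = Suc n" "S \<subseteq> B \<inter> points \<phi>"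
    using infinite_arbitrarily_large[OF inf] by blast
  have "of_nat (card S) = (\<Sum>x\<in>S. 1 :: ennreal)" by simp
  also have "\<dots> \<le> (\<Sum>x\<in>S. emeasure (as_measure \<phi>) {x})"
    using S by (intro sum_mono Nats_ennreal_ge_1 as_measure_bounded_Nats) (auto simp: points_def)
  also have "\<dots> = emeasure (as_measure \<phi>) S"
    using S by (intro emeasure_eq_sum_singleton[symmetric]) auto
  also have "\<dots> \<le> emeasure (as_measure \<phi>) (cball 0 r)"
    using S r by (intro emeasure_mono) auto
  finally have "of_nat (card S) \<le> (of_nat n :: ennreal)"
    unfolding n .
  with S show False by simp
qed

text \<open>The support of \<open>\<phi>\<close>, viewed again as a counting measure: every point of \<open>\<phi>\<close> gets mass one.\<close>

lift_definition support_measure ::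
  "'a::euclidean_space counting_measure \<Rightarrow> 'a counting_measure" is
  "\<lambda>M. distr (count_space {x. emeasure M {x} > 0}) borel (\<lambda>x. x)"
proof (intro conjI ballI impI)
  fix M :: "'a measure" and B :: "'a set"
  assume M: "sets M = sets borel \<and> (\<forall>B\<in>sets borel. bounded B \<longrightarrow> emeasure M B \<in> \<nat>)"
    and B: "B \<in> sets borel" "bounded B"
  define \<phi> where "\<phi> = Abs_counting_measure M"
  have "as_measure \<phi> = M"
    using M by (simp add: \<phi>_def Abs_counting_measure_inverse)
  then have "finite (B \<inter> {x. emeasure M {x} > 0})"
    using finite_bounded_points[OF B(2), of \<phi>] by (simp add: points_def)
  then show "emeasure (distr (count_space {x. emeasure M {x} > 0}) borel (\<lambda>x. x)) B \<in> \<nat>"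
    using B by (subst emeasure_distr) (auto simp: emeasure_count_space_finite)
qed auto

text \<open>\<open>translate t \<phi>\<close> is \<open>\<theta>\<^sub>t \<phi>\<close>, that is \<open>\<theta>\<^sub>t \<phi> (B) = \<phi> (B + t)\<close>.\<close>

lift_definition translate ::
  "'a::euclidean_space \<Rightarrow> 'a counting_measure \<Rightarrow> 'a counting_measure" is
  "\<lambda>t M. distr M borel (\<lambda>x. x - t)"
proof (intro conjI ballI impI)
  fix t :: 'a and M :: "'a measure" and B :: "'a set"
  assume M: "sets M = sets borel \<and> (\<forall>B\<in>sets borel. bounded B \<longrightarrow> emeasure M B \<in> \<nat>)"
    and B: "B \<in> sets borel" "bounded B"
  have [measurable_cong]: "sets M = sets borel" and sp: "space M = UNIV"
    using M sets_eq_imp_space_eq[of M borel] by auto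
  have eq: "(\<lambda>x. x - t) -` B = (\<lambda>x. x + t) ` B"
    by (force simp: image_iff)
  have "(\<lambda>x. x - t) -` B \<inter> space borel \<in> sets borel"
    using B by (intro measurable_sets[of _ borel borel]) auto
  moreover have "bounded ((\<lambda>x. x - t) -` B)"
    unfolding eq using bounded_translation[OF B(2), of t] by (simp add: add.commute)
  ultimately have "emeasure M ((\<lambda>x. x - t) -` B) \<in> \<nat>"
    using M by simp
  then show "emeasure (distr M borel (\<lambda>x. x - t)) B \<in> \<nat>"
    using B by (subst emeasure_distr) (auto simp: sp)
qed auto

lemma emeasure_translate:
  assumes "B \<in> sets borel"
  shows "emeasure (as_measure (translate t \<phi>)) B = emeasure (as_measure \<phi>) ((\<lambda>x. x + t) ` B)"
proof -
  have eq: "(\<lambda>x. x - t) -` B = (\<lambda>x. x + t) ` B"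
    by (force simp: image_iff)
  show ?thesis
    using assms by (simp add: translate.rep_eq emeasure_distr eq)
qed

lemma emeasure_support_measure:
  assumes "B \<in> sets borel"
  shows "emeasure (as_measure (support_measure \<phi>)) B = emeasure (count_space UNIV) (B \<inter> points \<phi>)"
proof -
  have "emeasure (as_measure (support_measure \<phi>)) B
      = emeasure (count_space (points \<phi>)) (B \<inter> points \<phi>)"
    using assms unfolding support_measure.rep_eq points_def
    by (subst emeasure_distr) auto
  also have "\<dots> = emeasure (count_space UNIV) (B \<inter> points \<phi>)"
    by (cases "finite (B \<inter> points \<phi>)")
       (auto simp: emeasure_count_space_finite emeasure_count_space_infinite)
  finally show ?thesis .
qed

definition simple_counting_measure :: "'a::euclidean_space counting_measure \<Rightarrow> bool" where
  "simple_counting_measure \<phi> \<longleftrightarrow> (\<forall>x. emeasure (as_measure \<phi>) {x} \<le> 1)"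

definition N0 :: "'a::euclidean_space counting_measure set" where
  "N0 = {\<phi>. 0 \<in> points \<phi>}"

abbreviation N0_space :: "'a::euclidean_space counting_measure measure" where
  "N0_space \<equiv> restrict_space borel N0"


section \<open>Point-maps and point-shifts\<close>

definition point_map :: "('a::euclidean_space counting_measure \<Rightarrow> 'a) \<Rightarrow> bool" where
  "point_map f \<longleftrightarrow> f \<in> measurable N0_space borel \<and>
     (\<forall>\<phi>\<in>N0. f \<phi> = f (support_measure \<phi>) \<and> f \<phi> \<in> points \<phi>)"

definition point_shift ::
  "('a::euclidean_space counting_measure \<Rightarrow> 'a) \<Rightarrow> 'a counting_measure \<Rightarrow> 'a \<Rightarrow> 'a" where
  "point_shift f \<phi> x = f (translate x \<phi>) + x"

definition shift_preimage ::
  "('a::euclidean_space counting_measure \<Rightarrow> 'a) \<Rightarrow> nat \<Rightarrow> 'a counting_measure \<Rightarrow> 'a \<Rightarrow> 'a set" where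
  "shift_preimage f n \<phi> y = {x \<in> points \<phi>. (point_shift f \<phi> ^^ n) x = y}"

definition point_map_translation ::
  "('a::euclidean_space counting_measure \<Rightarrow> 'a) \<Rightarrow> 'a counting_measure \<Rightarrow> 'a counting_measure" where
  "point_map_translation f \<phi> = translate (f \<phi>) \<phi>"


section \<open>Stationary point processes and Palm probabilities\<close>

locale stationary_point_process = prob_space P
  for P :: "'w measure" +
  fixes \<theta> :: "'a::euclidean_space \<Rightarrow> 'w \<Rightarrow> 'w"
    and \<Phi> :: "'w \<Rightarrow> 'a counting_measure"
  assumes flow_measurable: "(\<lambda>(t, \<omega>). \<theta> t \<omega>) \<in> measurable (borel \<Otimes>\<^sub>M P) P"
    and flow_zero: "\<omega> \<in> space P \<Longrightarrow> \<theta> 0 \<omega> = \<omega>"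
    and flow_add: "\<omega> \<in> space P \<Longrightarrow> \<theta> (s + t) \<omega> = \<theta> s (\<theta> t \<omega>)"
    and flow_invariant: "distr P P (\<theta> t) = P"
    and process_measurable: "\<Phi> \<in> measurable P borel"
    and process_compatible: "\<omega> \<in> space P \<Longrightarrow> \<Phi> (\<theta> t \<omega>) = translate t (\<Phi> \<omega>)"

definition intensity ::
  "'w measure \<Rightarrow> ('w \<Rightarrow> 'a::euclidean_space counting_measure) \<Rightarrow> ennreal" where
  "intensity P \<Phi> = (\<integral>\<^sup>+\<omega>. emeasure (as_measure (\<Phi> \<omega>)) (cbox 0 One) \<partial>P)"

text \<open>The set \<open>B\<close> is the auxiliary set in the defining formula; the result does not depend on it as
  long as its Lebesgue measure is positive and finite.\<close>

definition palm_probability ::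
  "'w measure \<Rightarrow> ('a::euclidean_space \<Rightarrow> 'w \<Rightarrow> 'w) \<Rightarrow> ('w \<Rightarrow> 'a counting_measure) \<Rightarrow> 'a set \<Rightarrow> 'w measure"
  where
  "palm_probability P \<theta> \<Phi> B = measure_of (space P) (sets P)
     (\<lambda>A. (\<integral>\<^sup>+\<omega>. (\<integral>\<^sup>+t. indicator B t * indicator A (\<theta> t \<omega>) \<partial>as_measure (\<Phi> \<omega>)) \<partial>P)
            / (intensity P \<Phi> * emeasure lborel B))"

text \<open>\<open>\<Phi>\<close> takes values in \<open>N0\<close> only almost surely for the Palm probability, whence the restriction
  of the push-forward to \<open>N0\<close>.\<close>

definition palm_distribution ::
  "'w measure \<Rightarrow> ('a::euclidean_space \<Rightarrow> 'w \<Rightarrow> 'w) \<Rightarrow> ('w \<Rightarrow> 'a counting_measure) \<Rightarrow> 'a set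
     \<Rightarrow> 'a counting_measure measure" where
  "palm_distribution P \<theta> \<Phi> B = restrict_space (distr (palm_probability P \<theta> \<Phi> B) borel \<Phi>) N0"

definition evaporates ::
  "'w measure \<Rightarrow> ('w \<Rightarrow> 'a::euclidean_space counting_measure)
     \<Rightarrow> ('a counting_measure \<Rightarrow> 'a) \<Rightarrow> bool" where
  "evaporates P \<Phi> f \<longleftrightarrow>
     (AE \<omega> in P. (\<Inter>n\<in>{1..}. {y \<in> points (\<Phi> \<omega>). shift_preimage f n (\<Phi> \<omega>) y \<noteq> {}}) = {})"


section \<open>Probability measures on \<open>N0\<close>\<close>

definition M1_N0 :: "'a::euclidean_space counting_measure measure set" where
  "M1_N0 = {\<mu>. sets \<mu> = sets N0_space \<and> prob_space \<mu>}"

definition weak_limit_N0 ::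
  "(nat \<Rightarrow> 'a::euclidean_space counting_measure measure) \<Rightarrow> 'a counting_measure measure \<Rightarrow> bool" where
  "weak_limit_N0 \<mu> \<nu> \<longleftrightarrow> (\<forall>n. \<mu> n \<in> M1_N0) \<and> \<nu> \<in> M1_N0 \<and>
     (\<forall>g :: 'a counting_measure \<Rightarrow> real. continuous_on N0 g \<and> bounded (g ` N0) \<longrightarrow>
        (\<lambda>n. \<integral>\<phi>. g \<phi> \<partial>\<mu> n) \<longlonglongrightarrow> (\<integral>\<phi>. g \<phi> \<partial>\<nu>))"

definition is_f_probability ::
  "('a::euclidean_space counting_measure \<Rightarrow> 'a) \<Rightarrow> 'a counting_measure measure
     \<Rightarrow> 'a counting_measure measure \<Rightarrow> bool" where
  "is_f_probability f P0 Q \<longleftrightarrow>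
     weak_limit_N0 (\<lambda>n. distr P0 N0_space (point_map_translation f ^^ n)) Q"

definition mutually_singular :: "'b measure \<Rightarrow> 'b measure \<Rightarrow> bool" where
  "mutually_singular M N \<longleftrightarrow>
     (\<exists>A \<in> sets M \<inter> sets N. emeasure M (space M - A) = 0 \<and> emeasure N A = 0)"

end

theory Submission
  imports Defs
begin

text \<open>
  The separating set is the set of all configurations \<open>\<phi>\<close> in \<open>N0\<close> for which the origin is an \<open>n\<close>-th
  image, that is \<open>F\<^sup>-\<^sup>n(\<phi>, 0) \<noteq> {}\<close>, for every \<open>n \<ge> 1\<close>.

  It has full measure under every \<open>Q\<close> that is invariant under \<open>\<theta>\<^sub>f\<close>: the configuration \<open>\<theta>\<^sub>f\<^sup>n \<phi>\<close> is \<open>\<phi>\<close>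
  seen from the \<open>n\<close>-th image of the origin, so the origin of \<open>\<theta>\<^sub>f\<^sup>n \<phi>\<close> is an \<open>n\<close>-th image
  (\<open>point_map_translation_funpow_in_nth_images\<close>), and \<open>Q\<close> is the law of \<open>\<theta>\<^sub>f\<^sup>n \<phi>\<close> when \<open>\<phi>\<close> has law \<open>Q\<close>
  (\<open>AE_nth_images\<close>). It is a null set of the Palm distribution: a point \<open>t\<close> of \<open>\<Phi>\<close> from which \<open>\<Phi>\<close> is
  seen as such a configuration has preimages of all orders, and evaporation says that almost surely
  no point does (\<open>palm_distribution_null\<close>).

  What remains is to show that the set is measurable, and this takes most of the work. Two facts about
  the Borel sigma-algebra of the vague topology are needed. First, \<open>\<phi> \<mapsto> \<phi>(A)\<close> is Borel, also for a set
  \<open>A\<close> that depends measurably on \<open>\<phi>\<close> (\<open>measurable_emeasure_section\<close>); this holds for a fixed open set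
  by monotone approximation with test functions, and in general by normalising \<open>\<phi>\<close> on balls to a
  subprobability kernel. Secondly, these evaluations generate the sigma-algebra
  (\<open>borel_measurable_counting_measureI\<close>), because a vaguely open set is a countable union of sets that
  prescribe finitely many counts. The second fact makes translation jointly measurable, and with it
  the iterates of the point-shift; the first then turns the existence of a preimage into the
  measurable condition that \<open>\<phi>\<close> charges the set of solutions.
\<close>

section \<open>Counting measures are carried by their points\<close>

lemma emeasure_bounded_less_top:
  "A \<in> sets borel \<Longrightarrow> bounded A \<Longrightarrow> emeasure (as_measure \<phi>) A < \<infinity>"
  by (intro Nats_ennreal_finite as_measure_bounded_Nats)

text \<open>
  A location that is not a point has a neighbourhood of measure zero, and countably many basic open
  sets suffice to cover all such locations.
\<close>

lemma AE_points: "AE x in as_measure \<phi>. x \<in> points \<phi>"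
proof -
  obtain \<B> :: "'a set set" where \<B>: "countable \<B>" "topological_basis \<B>"
    using ex_countable_basis by blast
  let ?N = "\<Union>{b \<in> \<B>. emeasure (as_measure \<phi>) b = 0}"
  have "(\<Union>b\<in>{b \<in> \<B>. emeasure (as_measure \<phi>) b = 0}. b) \<in> null_sets (as_measure \<phi>)"
    using \<B>
    by (intro null_sets_UN') (auto simp: null_sets_def topological_basis_open)
  then have "?N \<in> null_sets (as_measure \<phi>)"
    by simp
  then show ?thesis
  proof (rule AE_I')
    show "{x \<in> space (as_measure \<phi>). x \<notin> points \<phi>} \<subseteq> ?N"
    proof
      fix x assume "x \<in> {x \<in> space (as_measure \<phi>). x \<notin> points \<phi>}"
      then obtain U where U: "open U" "x \<in> U" "emeasure (as_measure \<phi>) U = 0"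
        by (auto simp: points_iff_support)
      then obtain b where b: "b \<in> \<B>" "x \<in> b" "b \<subseteq> U"
        using \<B>(2) topological_basisE by metis
      with U have "emeasure (as_measure \<phi>) b = 0"
        by (metis emeasure_mono le_zero_eq sets_as_measure borel_open)
      with b show "x \<in> ?N" by blast
    qed
  qed
qed

lemma emeasure_pos_iff_points:
  assumes "A \<in> sets borel"
  shows "emeasure (as_measure \<phi>) A > 0 \<longleftrightarrow> A \<inter> points \<phi> \<noteq> {}"
proof
  assume "emeasure (as_measure \<phi>) A > 0"
  show "A \<inter> points \<phi> \<noteq> {}"
  proof
    assume disjoint: "A \<inter> points \<phi> = {}"
    have "AE x in as_measure \<phi>. x \<notin> A"
      using AE_points[of \<phi>] by eventually_elim (use disjoint in auto)
    then have "emeasure (as_measure \<phi>) A = 0"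
      using assms by (subst (asm) AE_iff_measurable[of A]) auto
    with \<open>emeasure (as_measure \<phi>) A > 0\<close> show False by simp
  qed
next
  assume "A \<inter> points \<phi> \<noteq> {}"
  then obtain x where "x \<in> A" "0 < emeasure (as_measure \<phi>) {x}"
    by (auto simp: points_def)
  then show "emeasure (as_measure \<phi>) A > 0"
    using emeasure_mono[of "{x}" A "as_measure \<phi>"] assms by auto
qed

section \<open>Evaluations are Borel for the vague topology\<close>

lemma measurable_integral_test_function:
  fixes g :: "'a::euclidean_space \<Rightarrow> real"
  assumes "continuous_on UNIV g" "compact (closure {x. g x \<noteq> 0})"
  shows "(\<lambda>\<phi>. \<integral>x. g x \<partial>as_measure \<phi>) \<in> borel_measurable borel"
proof (rule borel_measurableI)
  fix V :: "real set" assume "open V"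
  with assms have "open {\<phi>. (\<integral>x. g x \<partial>as_measure \<phi>) \<in> V}"
    unfolding open_counting_measure_def by (intro generate_topology.Basis) blast
  then show "(\<lambda>\<phi>. \<integral>x. g x \<partial>as_measure \<phi>) -` V \<inter> space borel \<in> sets borel"
    by (simp add: vimage_def)
qed

lemma integrable_test_function:
  fixes g :: "'a::euclidean_space \<Rightarrow> real"
  assumes g: "continuous_on UNIV g" "compact (closure {x. g x \<noteq> 0})"
  shows "integrable (as_measure \<phi>) g"
proof -
  let ?K = "closure {x. g x \<noteq> 0}"
  have meas: "g \<in> borel_measurable borel"
    using g(1) by (rule borel_measurable_continuous_onI)
  obtain M where M: "\<And>x. x \<in> ?K \<Longrightarrow> \<bar>g x\<bar> \<le> M"
    using compact_imp_bounded[OF compact_continuous_image[OF continuous_on_subset[OF g(1)] g(2)]]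
    by (auto simp: bounded_iff)
  have K: "emeasure (as_measure \<phi>) ?K < \<infinity>"
    by (intro emeasure_bounded_less_top compact_imp_bounded g borel_closed) auto
  have dom: "integrable (as_measure \<phi>) (\<lambda>x. M * indicator ?K x)"
    using K by (intro integrable_mult_right integrable_real_indicator) auto
  have "norm (g x) \<le> norm (M * indicator ?K x :: real)" for x
    using M[of x] closure_subset[of "{x. g x \<noteq> 0}"]
    by (cases "x \<in> ?K") (auto simp: indicator_def)
  then show ?thesis
    by (intro Bochner_Integration.integrable_bound[OF dom]) (use meas in \<open>auto cong: measurable_cong_sets\<close>)
qed

text \<open>
  The vague topology controls only integrals of continuous functions with compact support. The
  indicator of an open set \<open>U\<close> is an increasing limit of such functions, namely
  \<open>min 1 (k * infdist x (- (U \<inter> ball 0 k)))\<close>: intersecting with the ball makes the supports compact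
  and keeps the complement nonempty.
\<close>

lemma measurable_eval_open:
  assumes "open U"
  shows "(\<lambda>\<phi>. emeasure (as_measure \<phi>) U) \<in> borel_measurable borel"
proof -
  define C where "C k = - (U \<inter> ball 0 (real k))" for k
  define g where "g k x = min 1 (real k * infdist x (C k))" for k and x :: 'a
  have C: "closed (C k)" "C k \<noteq> {}" for k
  proof -
    show "closed (C k)" using assms by (auto simp: C_def)
    have "bounded (U \<inter> ball 0 (real k))" by (rule bounded_Int) simp
    then show "C k \<noteq> {}" unfolding C_def using not_bounded_UNIV[where 'a='a]
      by (metis Compl_eq_Diff_UNIV Diff_eq_empty_iff top.extremum_uniqueI)
  qed
  have antimono: "infdist x (C j) \<le> infdist x (C k)" if "j \<le> k" for j k x
    using that C(2) by (intro infdist_mono) (auto simp: C_def)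
  have g0: "0 \<le> g k x" for k x by (auto simp: g_def infdist_nonneg)
  have cont: "continuous_on UNIV (g k)" for k
    unfolding g_def by (intro continuous_intros)
  have "{x. g k x \<noteq> 0} \<subseteq> cball 0 (real k)" for k
  proof
    fix x assume "x \<in> {x. g k x \<noteq> 0}"
    then have "infdist x (C k) \<noteq> 0" by (auto simp: g_def)
    then have "x \<notin> C k" by auto
    then show "x \<in> cball 0 (real k)" by (auto simp: C_def)
  qed
  then have supp: "compact (closure {x. g k x \<noteq> 0})" for k
    by (meson bounded_cball bounded_closure bounded_subset closed_closure compact_eq_bounded_closed)
  have mono: "incseq (\<lambda>k x. ennreal (g k x))"
    unfolding g_def
    by (intro incseq_SucI le_funI ennreal_leI min.mono mult_mono antimono) (auto simp: infdist_nonneg)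
  have sup: "(SUP k. ennreal (g k x)) = indicator U x" for x
  proof (cases "x \<in> U")
    case True
    obtain j where j: "norm x < real j" using reals_Archimedean2 by blast
    with True have "x \<notin> C j" by (auto simp: C_def)
    then have d: "infdist x (C j) > 0"
      using in_closed_iff_infdist_zero[OF C, of x j] infdist_nonneg[of x "C j"] by linarith
    obtain l where l: "1 / infdist x (C j) < real l" using reals_Archimedean2 by blast
    define k where "k = max j l"
    have "1 \<le> real l * infdist x (C j)" using l d by (simp add: field_simps)
    also have "\<dots> \<le> real k * infdist x (C k)"
      using antimono[of j k x] by (intro mult_mono) (auto simp: k_def infdist_nonneg)
    finally have "g k x = 1" by (simp add: g_def)
    then have "1 \<le> (SUP k. ennreal (g k x))"
      by (intro SUP_upper2[of k]) auto
    moreover have "(SUP k. ennreal (g k x)) \<le> 1"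
      by (intro SUP_least) (auto simp: g_def)
    ultimately show ?thesis using True by simp
  next
    case False
    then have "infdist x (C k) = 0" for k by (intro infdist_zero) (auto simp: C_def)
    with False show ?thesis by (simp add: g_def)
  qed
  have "emeasure (as_measure \<phi>) U = (SUP k. ennreal (\<integral>x. g k x \<partial>as_measure \<phi>))" for \<phi>
  proof -
    have "emeasure (as_measure \<phi>) U = (\<integral>\<^sup>+x. (SUP k. ennreal (g k x)) \<partial>as_measure \<phi>)"
      using assms by (simp add: sup)
    also have "\<dots> = (SUP k. \<integral>\<^sup>+x. ennreal (g k x) \<partial>as_measure \<phi>)"
      using cont by (intro nn_integral_monotone_convergence_SUP mono)
        (auto cong: measurable_cong_sets intro!: borel_measurable_continuous_onI measurable_compose[OF _ measurable_ennreal])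
    also have "\<dots> = (SUP k. ennreal (\<integral>x. g k x \<partial>as_measure \<phi>))"
      using g0 by (subst nn_integral_eq_integral) (auto intro!: integrable_test_function cont supp)
    finally show ?thesis .
  qed
  then show ?thesis
    using measurable_integral_test_function[OF cont supp] by simp
qed

section \<open>Counting measures as a kernel\<close>

text \<open>
  The map \<open>as_measure\<close> is a kernel whose values may have infinite mass. Restricting \<open>\<phi>\<close> to a ball
  and normalising gives a measurable map into the subprobability measures, so that the theory of the
  Giry monad yields measurability for sets with parameters. If the ball contains no points then the density is \<open>\<infinity>\<close> on a null set, so
  that the kernel takes the value zero there.
\<close>

definition window_kernel :: "nat \<Rightarrow> 'a::euclidean_space counting_measure \<Rightarrow> 'a measure" where
  "window_kernel m \<phi> = density (as_measure \<phi>)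
     (\<lambda>x. indicator (ball 0 (real m)) x / emeasure (as_measure \<phi>) (ball 0 (real m)))"

lemma emeasure_window_kernel:
  assumes "A \<in> sets borel"
  shows "emeasure (window_kernel m \<phi>) A
    = emeasure (as_measure \<phi>) (A \<inter> ball 0 (real m)) / emeasure (as_measure \<phi>) (ball 0 (real m))"
proof -
  let ?c = "emeasure (as_measure \<phi>) (ball 0 (real m))"
  have "emeasure (window_kernel m \<phi>) A
      = (\<integral>\<^sup>+x. indicator (ball 0 (real m)) x / ?c * indicator A x \<partial>as_measure \<phi>)"
    unfolding window_kernel_def using assms
    by (subst emeasure_density) (auto intro!: borel_measurable_divide_ennreal borel_measurable_indicator)
  also have "\<dots> = (\<integral>\<^sup>+x. indicator (A \<inter> ball 0 (real m)) x / ?c \<partial>as_measure \<phi>)"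
    by (intro nn_integral_cong) (auto simp: indicator_def)
  also have "\<dots> = emeasure (as_measure \<phi>) (A \<inter> ball 0 (real m)) / ?c"
    using assms by (subst nn_integral_divide) (auto intro!: borel_measurable_indicator)
  finally show ?thesis .
qed

lemma measurable_window_kernel:
  "window_kernel m \<in> measurable borel (subprob_algebra borel)"
proof (rule measurable_subprob_algebra_generated)
  show "sets borel = sigma_sets UNIV {S :: 'a set. open S}"
    by (simp add: borel_def)
  show "Int_stable {S :: 'a set. open S}"
    by (auto simp: Int_stable_def)
  have ev: "(\<lambda>\<phi>. emeasure (window_kernel m \<phi>) U) \<in> borel_measurable borel" if "open U" for U :: "'a set"
    using that by (subst emeasure_window_kernel)
      (auto intro!: borel_measurable_divide_ennreal measurable_eval_open)
  then show "(\<lambda>\<phi>. emeasure (window_kernel m \<phi>) U) \<in> borel_measurable borel"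
    if "U \<in> {S. open S}" for U :: "'a set" using that by simp
  show "(\<lambda>\<phi>. emeasure (window_kernel m \<phi>) (UNIV :: 'a set)) \<in> borel_measurable borel"
    by (rule ev) simp
  fix \<phi> :: "'a counting_measure"
  show "sets (window_kernel m \<phi>) = sets borel" by (simp add: window_kernel_def)
  show "subprob_space (window_kernel m \<phi>)"
  proof
    have "a / a \<le> 1" for a :: ennreal
      by (cases "a = 0 \<or> a = \<infinity>") (auto simp: ennreal_divide_self top.not_eq_extremum)
    then show "emeasure (window_kernel m \<phi>) (space (window_kernel m \<phi>)) \<le> 1"
      using emeasure_window_kernel[of UNIV m \<phi>] by (simp add: window_kernel_def)
    show "space (window_kernel m \<phi>) \<noteq> {}" by (simp add: window_kernel_def)
  qed
qed simp

lemma emeasure_eq_SUP_window_kernel: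
  fixes \<phi> :: "'a::euclidean_space counting_measure"
  assumes A: "A \<in> sets borel"
  shows "emeasure (as_measure \<phi>) A
    = (SUP m. emeasure (as_measure \<phi>) (ball 0 (real m)) * emeasure (window_kernel m \<phi>) A)"
proof -
  have "emeasure (as_measure \<phi>) (ball 0 (real m)) * emeasure (window_kernel m \<phi>) A
      = emeasure (as_measure \<phi>) (A \<inter> ball 0 (real m))" for m
  proof (cases "emeasure (as_measure \<phi>) (ball 0 (real m)) = 0")
    case True
    then have "emeasure (as_measure \<phi>) (A \<inter> ball 0 (real m)) = 0"
      using emeasure_mono[of "A \<inter> ball 0 (real m)" "ball 0 (real m)" "as_measure \<phi>"] A by auto
    with True show ?thesis by simp
  next
    case False
    moreover have "emeasure (as_measure \<phi>) (ball 0 (real m)) < \<infinity>"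
      by (intro emeasure_bounded_less_top) auto
    ultimately show ?thesis using A
      by (subst emeasure_window_kernel)
        (auto simp: ennreal_times_divide mult.commute[of _ "emeasure _ (A \<inter> _)"] ennreal_mult_divide_eq)
  qed
  moreover have "(SUP m. emeasure (as_measure \<phi>) (A \<inter> ball 0 (real m))) = emeasure (as_measure \<phi>) (\<Union>m. A \<inter> ball 0 (real m))"
    using A by (intro SUP_emeasure_incseq) (auto simp: incseq_def)
  moreover have "(\<Union>m. A \<inter> ball 0 (real m)) = A"
    using reals_Archimedean2 by auto
  ultimately show ?thesis by simp
qed

text \<open>
  The counting measure and the set may both depend on the parameter. This is the form in which
  point-shifts, which move the points of \<open>\<phi>\<close> in a way that depends on \<open>\<phi>\<close>, can be treated.
\<close>

lemma measurable_emeasure_section: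
  fixes h :: "'b \<Rightarrow> 'a::euclidean_space counting_measure"
  assumes h: "h \<in> borel_measurable M"
    and S: "{p \<in> space (M \<Otimes>\<^sub>M borel). snd p \<in> A (fst p)} \<in> sets (M \<Otimes>\<^sub>M borel)"
  shows "(\<lambda>x. emeasure (as_measure (h x)) (A x)) \<in> borel_measurable M"
proof -
  have eq: "{p \<in> space (M \<Otimes>\<^sub>M borel). snd p \<in> A (fst p)} = (SIGMA x:space M. A x)"
    by (auto simp: space_pair_measure)
  note S' = S[unfolded eq]
  have A: "A x \<in> sets borel" if "x \<in> space M" for x
    using sets_Pair1[OF S', of x] that by (simp add: vimage_def Sigma_def)
  have "(\<lambda>x. SUP m. emeasure (as_measure (h x)) (ball 0 (real m)) * emeasure (window_kernel m (h x)) (A x))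
      \<in> borel_measurable M"
    by (intro borel_measurable_SUP borel_measurable_times_ennreal
        measurable_compose[OF h measurable_eval_open] emeasure_measurable_subprob_algebra2[OF S']
        measurable_compose[OF h measurable_window_kernel]) auto
  then show ?thesis
    by (rule measurable_cong[THEN iffD1, rotated]) (simp add: emeasure_eq_SUP_window_kernel[OF A])
qed

section \<open>The vague Borel sigma-algebra is generated by the evaluations\<close>

text \<open>
  When every point of \<open>\<phi>\<close> in a window lies in one of finitely many small disjoint cells, the integral
  of \<open>g\<close> is determined by the cell counts up to the oscillation of \<open>g\<close>. Points in the window are
  captured by comparing the total mass with the sum of the masses of the cells.
\<close>

lemma integral_test_function_approx:
  fixes g :: "'a::euclidean_space \<Rightarrow> real"
  assumes g: "continuous_on UNIV g" "compact (closure {x. g x \<noteq> 0})"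
    and window: "W \<in> sets borel" "bounded W" "{x. g x \<noteq> 0} \<subseteq> W"
    and X: "finite X"
    and U: "\<And>x. x \<in> X \<Longrightarrow> U x \<in> sets borel" "\<And>x. x \<in> X \<Longrightarrow> U x \<subseteq> W" "disjoint_family_on U X"
    and osc: "\<And>x y. x \<in> X \<Longrightarrow> y \<in> U x \<Longrightarrow> \<bar>g y - g x\<bar> \<le> \<delta>"
    and full: "emeasure (as_measure \<phi>) W = (\<Sum>x\<in>X. emeasure (as_measure \<phi>) (U x))"
  shows "\<bar>(\<integral>y. g y \<partial>as_measure \<phi>) - (\<Sum>x\<in>X. g x * measure (as_measure \<phi>) (U x))\<bar>
    \<le> \<delta> * measure (as_measure \<phi>) W"
proof -
  let ?M = "as_measure \<phi>"
  define s where "s y = (\<Sum>x\<in>X. g x * indicator (U x) y)" for y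
  have fin: "emeasure ?M W < \<infinity>" "\<And>x. x \<in> X \<Longrightarrow> emeasure ?M (U x) < \<infinity>"
    using window U bounded_subset[OF window(2)] by (auto intro!: emeasure_bounded_less_top[simplified])
  have intU: "integrable ?M (\<lambda>y. g x * indicator (U x) y)" if "x \<in> X" for x
    using fin(2)[OF that] U(1)[OF that] by (intro integrable_mult_right integrable_real_indicator) auto
  have int_s: "integrable ?M s"
    unfolding s_def by (intro Bochner_Integration.integrable_sum intU)
  have "integral\<^sup>L ?M s = (\<Sum>x\<in>X. \<integral>y. g x * indicator (U x) y \<partial>?M)"
    unfolding s_def by (intro Bochner_Integration.integral_sum intU)
  then have s_eq: "integral\<^sup>L ?M s = (\<Sum>x\<in>X. g x * measure ?M (U x))"
    by simp
  have int_g: "integrable ?M g"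
    by (rule integrable_test_function[OF g])
  have int_O: "integrable ?M (\<lambda>y. \<delta> * indicator W y)"
    using fin(1) window by (intro integrable_mult_right integrable_real_indicator) auto
  have "(\<Union>x\<in>X. U x) \<in> sets ?M" using X U(1) by (intro sets.finite_UN) auto
  moreover have "emeasure ?M (\<Union>x\<in>X. U x) = emeasure ?M W"
    unfolding full using X U by (intro sum_emeasure[symmetric]) auto
  ultimately have "emeasure ?M (W - (\<Union>x\<in>X. U x)) = 0"
    using U(2) fin(1) window(1) by (subst emeasure_Diff) auto
  then have "AE y in ?M. y \<notin> W - (\<Union>x\<in>X. U x)"
    using window(1) \<open>(\<Union>x\<in>X. U x) \<in> sets ?M\<close> by (intro AE_not_in) (auto simp: null_sets_def)
  \<comment> \<open>Off a null set, \<open>s\<close> is the value of \<open>g\<close> at the centre of the cell that contains \<open>y\<close>.\<close>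
  then have "AE y in ?M. \<bar>g y - s y\<bar> \<le> \<delta> * indicator W y"
  proof eventually_elim
    fix y assume y: "y \<notin> W - (\<Union>x\<in>X. U x)"
    show "\<bar>g y - s y\<bar> \<le> \<delta> * indicator W y"
    proof (cases "y \<in> W")
      case True
      with y obtain x where x: "x \<in> X" "y \<in> U x" by blast
      have "s y = (\<Sum>z\<in>X. if z = x then g x else 0)"
        unfolding s_def using U(3) x by (intro sum.cong) (auto simp: disjoint_family_on_def indicator_def)
      then have "s y = g x" using x X by simp
      with osc[OF x] True show ?thesis by simp
    next
      case False
      then have "s y = 0" unfolding s_def using U(2) by (intro sum.neutral) (auto simp: indicator_def)
      with False window(3) show ?thesis by auto
    qed
  qed
  then have "(\<integral>y. \<bar>g y - s y\<bar> \<partial>?M) \<le> (\<integral>y. \<delta> * indicator W y \<partial>?M)"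
    by (intro integral_mono_AE int_O integrable_abs Bochner_Integration.integrable_diff int_g int_s)
  moreover have "\<bar>\<integral>y. g y - s y \<partial>?M\<bar> \<le> (\<integral>y. \<bar>g y - s y\<bar> \<partial>?M)"
    by (rule integral_abs_bound)
  moreover have "(\<integral>y. g y - s y \<partial>?M) = integral\<^sup>L ?M g - integral\<^sup>L ?M s"
    by (intro Bochner_Integration.integral_diff int_g int_s)
  ultimately show ?thesis
    using window(1) by (simp add: s_eq)
qed

text \<open>
  The elements of \<open>\<D>\<close> need not be open. This freedom is what makes exact counts usable as
  a substitute for neighbourhoods.
\<close>

lemma generate_topology_refine:
  assumes V: "generate_topology \<G> V" "x \<in> V"
    and basis: "\<And>A y. A \<in> \<G> \<Longrightarrow> y \<in> A \<Longrightarrow> \<exists>W\<in>\<D>. y \<in> W \<and> W \<subseteq> A"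
    and closed: "UNIV \<in> \<D>" "\<And>W W'. W \<in> \<D> \<Longrightarrow> W' \<in> \<D> \<Longrightarrow> W \<inter> W' \<in> \<D>"
  shows "\<exists>W\<in>\<D>. x \<in> W \<and> W \<subseteq> V"
  using V
proof (induction arbitrary: x)
  case UNIV
  with closed(1) show ?case by blast
next
  case (Int a b)
  then have "x \<in> a" "x \<in> b" by auto
  obtain W where W: "W \<in> \<D>" "x \<in> W" "W \<subseteq> a"
    using Int.IH(1)[OF \<open>x \<in> a\<close>] by (elim bexE conjE)
  obtain W' where W': "W' \<in> \<D>" "x \<in> W'" "W' \<subseteq> b"
    using Int.IH(2)[OF \<open>x \<in> b\<close>] by (elim bexE conjE)
  show ?case
    using W W' closed(2)[OF W(1) W'(1)] by (intro bexI[of _ "W \<inter> W'"] conjI Int_mono) simp_all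
next
  case (UN K)
  from UN.prems obtain k where "k \<in> K" "x \<in> k" by blast
  from UN.IH[OF this] \<open>k \<in> K\<close> show ?case by (elim bexE) blast
next
  case (Basis A)
  then show ?case using basis by blast
qed

text \<open>
  The measure \<open>\<phi>\<close> has finitely many points in a ball \<open>W\<close> that contains the support of \<open>g\<close>. Enclose
  them in disjoint basic open sets on which \<open>g\<close> is nearly constant. A counting measure with the same
  counts on these sets and on \<open>W\<close> has no further points in \<open>W\<close>, and hence nearly the same integral.
\<close>

lemma vague_nbhd_from_counts:
  fixes \<B> :: "'a::euclidean_space set set" and g :: "'a \<Rightarrow> real"
  assumes \<B>: "topological_basis \<B>"
    and g: "continuous_on UNIV g" "compact (closure {x. g x \<noteq> 0})"
    and V: "open V" "(\<integral>x. g x \<partial>as_measure \<phi>) \<in> V"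
  obtains \<U> where "finite \<U>" "\<U> \<subseteq> \<B> \<union> range (\<lambda>m. ball 0 (real m))"
    "\<And>U. U \<in> \<U> \<Longrightarrow> bounded U"
    "\<And>\<psi>. (\<And>U. U \<in> \<U> \<Longrightarrow> emeasure (as_measure \<psi>) U = emeasure (as_measure \<phi>) U)
      \<Longrightarrow> (\<integral>x. g x \<partial>as_measure \<psi>) \<in> V"
proof -
  obtain r where r: "closure {x. g x \<noteq> 0} \<subseteq> ball 0 r"
    using bounded_subset_ballD[OF compact_imp_bounded[OF g(2)], of 0] by blast
  obtain m where m: "r < real m" using reals_Archimedean2 by blast
  define W where "W = ball (0::'a) (real m)"
  have W: "W \<in> sets borel" "bounded W" "open W" by (auto simp: W_def)
  have supp: "{x. g x \<noteq> 0} \<subseteq> W"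
    using r m closure_subset[of "{x. g x \<noteq> 0}"] subset_ball[of r "real m" "0::'a"] by (auto simp: W_def)
  define X where "X = W \<inter> points \<phi>"
  have X: "finite X" unfolding X_def using W by (intro finite_bounded_points)
  obtain e where e: "e > 0" "\<And>t. \<bar>t - (\<integral>x. g x \<partial>as_measure \<phi>)\<bar> < e \<Longrightarrow> t \<in> V"
    using V by (auto simp: open_dist dist_real_def)
  define c where "c = measure (as_measure \<phi>) W"
  have c: "c \<ge> 0" by (simp add: c_def)
  \<comment> \<open>The integrals for \<open>\<phi>\<close> and \<open>\<psi>\<close> are each within \<open>\<delta> * c\<close> of the same sum, which costs
    \<open>2 * (\<delta> * c)\<close>; adding one in the denominator allows for \<open>c = 0\<close>.\<close>
  define \<delta> where "\<delta> = e / (2 * c + 1)"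
  have \<delta>: "\<delta> > 0" "2 * (\<delta> * c) < e"
    using e(1) c by (auto simp: \<delta>_def field_simps)
  \<comment> \<open>Balls of radius \<open>d x / 2\<close> around distinct points \<open>x\<close> of \<open>X\<close> are disjoint.\<close>
  have "\<exists>d>0. \<forall>y\<in>X. y \<noteq> x \<longrightarrow> d \<le> dist x y" for x
    by (rule finite_set_avoid[OF X])
  then obtain d where d: "\<And>x. d x > 0" "\<And>x y. y \<in> X \<Longrightarrow> y \<noteq> x \<Longrightarrow> d x \<le> dist x y" by metis
  have "\<exists>b\<in>\<B>. x \<in> b \<and> b \<subseteq> W \<inter> ball x (d x / 2) \<inter> {y. \<bar>g y - g x\<bar> < \<delta>}" if "x \<in> X" for x
  proof -
    have "open {y. \<bar>g y - g x\<bar> < \<delta>}"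
      by (intro open_Collect_less continuous_intros g)
    then have "open (W \<inter> ball x (d x / 2) \<inter> {y. \<bar>g y - g x\<bar> < \<delta>})"
      using W by (intro open_Int) auto
    moreover have "x \<in> W \<inter> ball x (d x / 2) \<inter> {y. \<bar>g y - g x\<bar> < \<delta>}"
      using that d(1) \<delta> by (auto simp: X_def)
    ultimately show ?thesis using \<B> topological_basisE by metis
  qed
  then obtain U where U: "\<And>x. x \<in> X \<Longrightarrow> U x \<in> \<B>" "\<And>x. x \<in> X \<Longrightarrow> x \<in> U x"
    "\<And>x. x \<in> X \<Longrightarrow> U x \<subseteq> W \<inter> ball x (d x / 2) \<inter> {y. \<bar>g y - g x\<bar> < \<delta>}" by metis
  have Ub: "U x \<in> sets borel" if "x \<in> X" for x
    using U(1)[OF that] topological_basis_open[OF \<B>] by auto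
  have disj: "disjoint_family_on U X"
  proof (unfold disjoint_family_on_def, intro ballI impI, rule ccontr)
    fix x y assume xy: "x \<in> X" "y \<in> X" "x \<noteq> y" "U x \<inter> U y \<noteq> {}"
    then obtain z where "z \<in> U x" "z \<in> U y" by blast
    then have "z \<in> ball x (d x / 2)" "z \<in> ball y (d y / 2)" using U(3) xy(1,2) by blast+
    then have "dist x z < d x / 2" "dist y z < d y / 2" by (simp_all only: mem_ball)
    moreover have "d x \<le> dist x y" "d y \<le> dist y x" using d(2) xy by auto
    moreover have "dist x y \<le> dist x z + dist y z" by (rule dist_triangle2)
    ultimately show False by (simp add: dist_commute)
  qed
  define \<U> where "\<U> = insert W (U ` X)"
  have same: "\<bar>(\<integral>y. g y \<partial>as_measure \<psi>) - (\<Sum>x\<in>X. g x * measure (as_measure \<phi>) (U x))\<bar> \<le> \<delta> * c"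
    if \<psi>: "\<And>A. A \<in> \<U> \<Longrightarrow> emeasure (as_measure \<psi>) A = emeasure (as_measure \<phi>) A" for \<psi>
  proof -
    have meas: "measure (as_measure \<psi>) A = measure (as_measure \<phi>) A" if "A \<in> \<U>" for A
      using \<psi>[OF that] by (simp add: measure_def)
    have sub: "(\<Union>x\<in>X. U x) \<subseteq> W" using U(3) by blast
    have sup: "W \<inter> points \<phi> \<subseteq> (\<Union>x\<in>X. U x)" using U(2) by (auto simp only: X_def)
    have "AE y in as_measure \<phi>. y \<in> W \<longleftrightarrow> y \<in> (\<Union>x\<in>X. U x)"
      using AE_points[of \<phi>] by eventually_elim (use sub sup in blast)
    then have "emeasure (as_measure \<phi>) W = emeasure (as_measure \<phi>) (\<Union>x\<in>X. U x)"
      using W Ub X by (intro emeasure_eq_AE) auto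
    also have "\<dots> = (\<Sum>x\<in>X. emeasure (as_measure \<phi>) (U x))"
      using Ub X disj by (intro sum_emeasure[symmetric]) auto
    finally have "emeasure (as_measure \<psi>) W = (\<Sum>x\<in>X. emeasure (as_measure \<psi>) (U x))"
      using \<psi> by (simp add: \<U>_def)
    then have "\<bar>(\<integral>y. g y \<partial>as_measure \<psi>) - (\<Sum>x\<in>X. g x * measure (as_measure \<psi>) (U x))\<bar>
        \<le> \<delta> * measure (as_measure \<psi>) W"
    proof (intro integral_test_function_approx g W supp X Ub disj)
      show "U x \<subseteq> W" if "x \<in> X" for x using U(3)[OF that] by blast
      show "\<bar>g y - g x\<bar> \<le> \<delta>" if "x \<in> X" "y \<in> U x" for x y
        using U(3)[OF that(1)] that(2) less_imp_le by blast
    qed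
    then show ?thesis using meas by (simp add: \<U>_def c_def)
  qed
  show ?thesis
  proof (rule that[of \<U>])
    show "finite \<U>" using X by (simp add: \<U>_def)
    show "\<U> \<subseteq> \<B> \<union> range (\<lambda>m. ball 0 (real m))" using U(1) unfolding \<U>_def W_def by blast
    show "bounded A" if "A \<in> \<U>" for A
    proof -
      have "A \<subseteq> W" using that U(3) unfolding \<U>_def by blast
      then show ?thesis using W(2) bounded_subset by blast
    qed
    show "(\<integral>x. g x \<partial>as_measure \<psi>) \<in> V"
      if "\<And>A. A \<in> \<U> \<Longrightarrow> emeasure (as_measure \<psi>) A = emeasure (as_measure \<phi>) A" for \<psi>
    proof (rule e(2))
      have "\<bar>(\<integral>y. g y \<partial>as_measure \<psi>) - (\<Sum>x\<in>X. g x * measure (as_measure \<phi>) (U x))\<bar> \<le> \<delta> * c"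
        using that by (rule same)
      moreover have "\<bar>(\<integral>y. g y \<partial>as_measure \<phi>) - (\<Sum>x\<in>X. g x * measure (as_measure \<phi>) (U x))\<bar> \<le> \<delta> * c"
        by (rule same) simp
      ultimately show "\<bar>(\<integral>x. g x \<partial>as_measure \<psi>) - (\<integral>x. g x \<partial>as_measure \<phi>)\<bar> < e"
        using \<delta>(2) by linarith
    qed
  qed
qed

text \<open>
  The subbase that defines the vague topology is uncountable, so preimages of its members do not
  suffice. By \<open>vague_nbhd_from_counts\<close>, every vaguely open set is a union of members of the countable family
  \<open>\<D>\<close> of finite intersections of cells, where a cell prescribes the count of one basic set.
\<close>

lemma borel_measurable_counting_measureI:
  fixes h :: "'b \<Rightarrow> 'a::euclidean_space counting_measure"
  assumes "\<And>U. open U \<Longrightarrow> (\<lambda>x. emeasure (as_measure (h x)) U) \<in> borel_measurable M"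
  shows "h \<in> borel_measurable M"
proof (rule borel_measurableI)
  fix V :: "'a counting_measure set" assume V: "open V"
  obtain \<B> :: "'a set set" where \<B>: "countable \<B>" "topological_basis \<B>"
    using ex_countable_basis by blast
  define cell where "cell U n = {\<phi>::'a counting_measure. emeasure (as_measure \<phi>) U = of_nat n}" for U n
  define \<C> where "\<C> = (\<lambda>(U, n). cell U n) ` ((\<B> \<union> range (\<lambda>m. ball 0 (real m))) \<times> UNIV)"
  define \<D> where "\<D> = Inter ` {F. finite F \<and> F \<subseteq> \<C>}"
  have "countable \<C>" using \<B>(1) by (auto simp: \<C>_def)
  then have cD: "countable \<D>" unfolding \<D>_def by (intro countable_image countable_Collect_finite_subset)
  have D_Int: "W \<inter> W' \<in> \<D>" if "W \<in> \<D>" "W' \<in> \<D>" for W W'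
  proof -
    from that obtain F F' where "finite F" "F \<subseteq> \<C>" "W = \<Inter>F" "finite F'" "F' \<subseteq> \<C>" "W' = \<Inter>F'"
      by (auto simp: \<D>_def)
    then show ?thesis unfolding \<D>_def by (intro image_eqI[of _ _ "F \<union> F'"]) auto
  qed
  have UNIV_D: "UNIV \<in> \<D>" unfolding \<D>_def by (intro image_eqI[of _ _ "{}"]) auto
  have local: "\<exists>W\<in>\<D>. \<phi> \<in> W \<and> W \<subseteq> V" if "\<phi> \<in> V" for \<phi>
  proof (rule generate_topology_refine[OF V[unfolded open_counting_measure_def] that _ UNIV_D D_Int])
    fix A \<phi>
    assume "A \<in> {{\<phi>. (\<integral>x. g x \<partial>as_measure \<phi>) \<in> V} | (g :: 'a \<Rightarrow> real) V.
        continuous_on UNIV g \<and> compact (closure {x. g x \<noteq> 0}) \<and> open V}" and "\<phi> \<in> A"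
    then obtain g :: "'a \<Rightarrow> real" and V' where A: "A = {\<phi>. (\<integral>x. g x \<partial>as_measure \<phi>) \<in> V'}"
      and g: "continuous_on UNIV g" "compact (closure {x. g x \<noteq> 0})" "open V'"
        "(\<integral>x. g x \<partial>as_measure \<phi>) \<in> V'"
      by auto
    obtain \<U> where \<U>: "finite \<U>" "\<U> \<subseteq> \<B> \<union> range (\<lambda>m. ball 0 (real m))" "\<And>U. U \<in> \<U> \<Longrightarrow> bounded U"
      "\<And>\<psi>. (\<And>U. U \<in> \<U> \<Longrightarrow> emeasure (as_measure \<psi>) U = emeasure (as_measure \<phi>) U)
        \<Longrightarrow> (\<integral>x. g x \<partial>as_measure \<psi>) \<in> V'"
      using vague_nbhd_from_counts[OF \<B>(2) g] by blast
    have "\<exists>n. emeasure (as_measure \<phi>) U = of_nat n" if "U \<in> \<U>" for U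
    proof -
      have "U \<in> sets borel" using that \<U>(2) topological_basis_open[OF \<B>(2)] by auto
      from as_measure_bounded_Nats[OF this \<U>(3)[OF that], of \<phi>] show ?thesis by (auto elim: Nats_cases)
    qed
    then obtain n where n: "\<And>U. U \<in> \<U> \<Longrightarrow> emeasure (as_measure \<phi>) U = of_nat (n U)" by metis
    let ?W = "\<Inter>U\<in>\<U>. cell U (n U)"
    have "cell U (n U) \<in> \<C>" if "U \<in> \<U>" for U
      unfolding \<C>_def using \<U>(2) that by (intro image_eqI[of _ _ "(U, n U)"]) auto
    then have "(\<lambda>U. cell U (n U)) ` \<U> \<subseteq> \<C>" by blast
    then have "?W \<in> \<D>" unfolding \<D>_def using \<U>(1) by (intro imageI) simp
    moreover have "\<phi> \<in> ?W" using n by (simp add: cell_def)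
    moreover have "?W \<subseteq> A" using \<U>(4) n by (auto simp: cell_def A)
    ultimately show "\<exists>W\<in>\<D>. \<phi> \<in> W \<and> W \<subseteq> A" by blast
  qed
  have W_meas: "h -` W \<inter> space M \<in> sets M" if "W \<in> \<D>" for W
  proof -
    from that obtain F where F: "finite F" "F \<subseteq> \<C>" "W = \<Inter>F" by (auto simp: \<D>_def)
    have "h -` C \<inter> space M \<in> sets M" if "C \<in> F" for C
    proof -
      from that F(2) have "C \<in> \<C>" by blast
      then have "\<exists>U n. U \<in> \<B> \<union> range (\<lambda>m. ball 0 (real m)) \<and> C = cell U n"
        unfolding \<C>_def by (elim imageE SigmaE) (simp only: case_prod_conv, blast)
      then obtain U n where U: "U \<in> \<B> \<union> range (\<lambda>m. ball 0 (real m))" "C = cell U n"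
        by (elim exE conjE)
      then have "open U" using topological_basis_open[OF \<B>(2)] by auto
      from measurable_sets[OF assms[OF this], of "{of_nat n}"]
      show ?thesis by (simp add: U cell_def vimage_def)
    qed
    then have "{x \<in> space M. \<forall>C\<in>F. x \<in> h -` C} \<in> sets M"
      using F(1) by (intro sets.sets_Collect_finite_All) (auto simp: vimage_def Int_def conj_commute)
    moreover have "h -` W \<inter> space M = {x \<in> space M. \<forall>C\<in>F. x \<in> h -` C}" by (auto simp: F(3))
    ultimately show ?thesis by simp
  qed
  have "h -` V \<inter> space M = (\<Union>W\<in>{W \<in> \<D>. W \<subseteq> V}. h -` W \<inter> space M)"
    using local by blast
  also have "\<dots> \<in> sets M"
    using cD W_meas by (intro sets.countable_UN'') auto
  finally show "h -` V \<inter> space M \<in> sets M" .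
qed

section \<open>Translations and point-shifts\<close>

lemma measurable_translate [measurable]:
  "(\<lambda>p. translate (fst p) (snd p)) \<in> borel \<Otimes>\<^sub>M borel \<rightarrow>\<^sub>M (borel :: 'a::euclidean_space counting_measure measure)"
proof (rule borel_measurable_counting_measureI)
  fix U :: "'a set" assume [measurable]: "open U"
  have "emeasure (as_measure (translate (fst p) (snd p))) U
      = emeasure (as_measure (snd p)) {y. y - fst p \<in> U}" for p :: "'a \<times> 'a counting_measure"
  proof -
    have "(\<lambda>x. x + fst p) ` U = {y. y - fst p \<in> U}" by (force simp: image_iff)
    with \<open>open U\<close> show ?thesis by (simp add: emeasure_translate)
  qed
  moreover have "(\<lambda>p. emeasure (as_measure (snd p)) {y. y - fst p \<in> U})
      \<in> borel_measurable (borel \<Otimes>\<^sub>M (borel :: 'a counting_measure measure))"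
  proof (rule measurable_emeasure_section)
    have [measurable]: "U \<in> sets borel" using \<open>open U\<close> by simp
    show "{p \<in> space ((borel \<Otimes>\<^sub>M (borel :: 'a counting_measure measure)) \<Otimes>\<^sub>M borel).
        snd p \<in> {y. y - fst (fst p) \<in> U}} \<in> sets ((borel \<Otimes>\<^sub>M borel) \<Otimes>\<^sub>M borel)"
      unfolding mem_Collect_eq by measurable
  qed simp
  ultimately show "(\<lambda>p. emeasure (as_measure (translate (fst p) (snd p))) U)
      \<in> borel_measurable (borel \<Otimes>\<^sub>M (borel :: 'a counting_measure measure))"
    by simp
qed

lemma points_translate: "x \<in> points (translate t \<phi>) \<longleftrightarrow> x + t \<in> points \<phi>"
  by (simp add: points_def emeasure_translate)

lemma translate_in_N0_iff: "translate t \<phi> \<in> N0 \<longleftrightarrow> t \<in> points \<phi>"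
  by (simp add: N0_def points_translate)

lemma translate_translate: "translate s (translate t \<phi>) = translate (s + t) \<phi>"
proof -
  have "as_measure (translate s (translate t \<phi>)) = as_measure (translate (s + t) \<phi>)"
    by (simp add: translate.rep_eq distr_distr comp_def algebra_simps)
  then show ?thesis by (simp add: as_measure_inject)
qed

lemma translate_zero: "translate 0 \<phi> = \<phi>"
proof -
  have "as_measure (translate 0 \<phi>) = as_measure \<phi>"
    by (rule measure_eqI) (auto simp: emeasure_translate)
  then show ?thesis by (simp add: as_measure_inject)
qed

lemma measurable_eval:
  assumes "A \<in> sets borel"
  shows "(\<lambda>\<phi>. emeasure (as_measure \<phi>) A) \<in> borel_measurable borel"
  using assms by (intro measurable_emeasure_section) auto

lemma sets_N0 [measurable]: "N0 \<in> sets borel"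
proof -
  have "{\<phi> \<in> space borel. 0 < emeasure (as_measure \<phi>) {0 :: 'a}} \<in> sets borel"
    using measurable_eval[of "{0 :: 'a}"] by (intro borel_measurable_less) auto
  then show ?thesis by (simp add: N0_def points_def)
qed

lemma point_shift_in_points:
  assumes "point_map f" "x \<in> points \<phi>"
  shows "point_shift f \<phi> x \<in> points \<phi>"
  using assms translate_in_N0_iff[of x \<phi>]
  unfolding point_map_def point_shift_def points_translate[symmetric] by blast

lemma point_shift_funpow_in_points:
  assumes "point_map f" "x \<in> points \<phi>"
  shows "(point_shift f \<phi> ^^ n) x \<in> points \<phi>"
  by (induction n) (simp_all add: assms point_shift_in_points)

lemma point_shift_translate:
  "point_shift f (translate t \<phi>) x = point_shift f \<phi> (x + t) - t"
  by (simp add: point_shift_def translate_translate)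

lemma point_shift_funpow_translate:
  "(point_shift f (translate t \<phi>) ^^ n) x = (point_shift f \<phi> ^^ n) (x + t) - t"
  by (induction n) (simp_all add: point_shift_translate)

lemma point_map_translation_funpow:
  "(point_map_translation f ^^ n) \<phi> = translate ((point_shift f \<phi> ^^ n) 0) \<phi>"
  by (induction n)
    (simp_all add: translate_zero point_map_translation_def translate_translate point_shift_def)

text \<open>
  The configurations whose point at the origin is an \<open>n\<close>-th image under the point-shift. The points of
  \<open>\<phi>\<close> that are \<open>n\<close>-th images are exactly those from which \<open>\<phi>\<close> is seen as such a configuration
  (lemma \<open>translate_in_nth_images_iff\<close>).
\<close>

definition nth_images :: "('a::euclidean_space counting_measure \<Rightarrow> 'a) \<Rightarrow> nat \<Rightarrow> 'a counting_measure set" where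
  "nth_images f n = {\<phi> \<in> N0. shift_preimage f n \<phi> 0 \<noteq> {}}"

text \<open>
  The \<open>n\<close>-fold translation recentres \<open>\<phi>\<close> at the \<open>n\<close>-th image of the origin. Seen from there, the old
  origin sits at \<open>- t\<close> and is mapped to the new origin.
\<close>

lemma point_map_translation_funpow_in_nth_images:
  assumes f: "point_map f" and \<phi>: "\<phi> \<in> N0"
  shows "(point_map_translation f ^^ n) \<phi> \<in> nth_images f n"
proof -
  define t where "t = (point_shift f \<phi> ^^ n) 0"
  have "0 \<in> points \<phi>" using \<phi> by (simp add: N0_def)
  then have "t \<in> points \<phi>" unfolding t_def by (rule point_shift_funpow_in_points[OF f])
  moreover have "- t \<in> shift_preimage f n (translate t \<phi>) 0"
    using \<open>0 \<in> points \<phi>\<close>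
    by (simp add: shift_preimage_def points_translate point_shift_funpow_translate t_def)
  ultimately show ?thesis
    by (auto simp: nth_images_def point_map_translation_funpow translate_in_N0_iff simp flip: t_def)
qed

lemma translate_in_nth_images_iff:
  "translate t \<phi> \<in> nth_images f n \<longleftrightarrow> t \<in> points \<phi> \<and> shift_preimage f n \<phi> t \<noteq> {}"
proof -
  have "shift_preimage f n (translate t \<phi>) 0 = (\<lambda>x. x - t) ` shift_preimage f n \<phi> t"
    by (force simp: shift_preimage_def points_translate point_shift_funpow_translate image_iff)
  then show ?thesis by (simp add: nth_images_def translate_in_N0_iff)
qed

lemma measurable_point_shift_funpow:
  fixes f :: "'a::euclidean_space counting_measure \<Rightarrow> 'a"
  assumes [measurable]: "f \<in> borel_measurable borel"
  shows "(\<lambda>p. (point_shift f (fst p) ^^ n) (snd p)) \<in> borel_measurable (borel \<Otimes>\<^sub>M borel)"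
proof (induction n)
  case 0
  show ?case by simp
next
  case (Suc n)
  note [measurable] = Suc
  have tr: "(\<lambda>p. translate ((point_shift f (fst p) ^^ n) (snd p)) (fst p)) \<in> borel \<Otimes>\<^sub>M borel \<rightarrow>\<^sub>M borel"
    by (rule measurable_compose[OF measurable_Pair[OF Suc measurable_fst] measurable_translate, simplified])
  show ?case
    unfolding funpow.simps comp_def point_shift_def[of f "fst _" "(_ ^^ n) _"]
    by (intro borel_measurable_add measurable_compose[OF tr assms] Suc)
qed

text \<open>
  The preimage of the origin consists of the points of \<open>\<phi>\<close> in the set \<open>Z \<phi>\<close> of solutions of
  \<open>F\<^sup>n(\<phi>, x) = 0\<close>, so it is nonempty if and only if \<open>\<phi>\<close> charges \<open>Z \<phi>\<close>. Extending \<open>f\<close> by zero outside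
  \<open>N0\<close> makes this equation meaningful and measurable for all \<open>x\<close>, without changing the orbits of
  points.
\<close>

lemma sets_nth_images:
  fixes f :: "'a::euclidean_space counting_measure \<Rightarrow> 'a"
  assumes f: "point_map f"
  shows "nth_images f n \<in> sets borel"
proof -
  define f' where "f' \<phi> = (if \<phi> \<in> N0 then f \<phi> else 0)" for \<phi>
  have "f \<in> borel_measurable N0_space" using f by (simp add: point_map_def)
  then have f': "f' \<in> borel_measurable borel"
    unfolding f'_def by (subst measurable_restrict_space_iff[symmetric]) auto
  define Z where "Z \<phi> = {x. (point_shift f' \<phi> ^^ n) x = 0}" for \<phi>
  note [measurable] = measurable_point_shift_funpow[OF f', of n]
  have "(point_shift f' \<phi> ^^ n) x = (point_shift f \<phi> ^^ n) x" if "x \<in> points \<phi>" for \<phi> x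
  proof (induction n)
    case (Suc n)
    have "(point_shift f \<phi> ^^ n) x \<in> points \<phi>"
      by (rule point_shift_funpow_in_points[OF f that])
    then have "point_shift f' \<phi> ((point_shift f \<phi> ^^ n) x) = point_shift f \<phi> ((point_shift f \<phi> ^^ n) x)"
      unfolding point_shift_def[of f'] point_shift_def[of f _ "(_ ^^ n) x"] f'_def
      by (simp add: translate_in_N0_iff)
    with Suc show ?case by simp
  qed simp
  then have Z: "shift_preimage f n \<phi> 0 = Z \<phi> \<inter> points \<phi>" for \<phi>
    by (auto simp: Z_def shift_preimage_def)
  have joint: "{p \<in> space (borel \<Otimes>\<^sub>M borel). snd p \<in> Z (fst p)} \<in> sets (borel \<Otimes>\<^sub>M borel)"
    unfolding Z_def mem_Collect_eq by measurable
  have "Z \<phi> \<in> sets borel" for \<phi>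
    using sets_Pair1[OF joint, of \<phi>] by (simp add: vimage_def space_pair_measure)
  then have "nth_images f n = {\<phi> \<in> space borel. \<phi> \<in> N0 \<and> 0 < emeasure (as_measure \<phi>) (Z \<phi>)}"
    by (auto simp: nth_images_def Z emeasure_pos_iff_points)
  moreover have [measurable]: "(\<lambda>\<phi>. emeasure (as_measure \<phi>) (Z \<phi>)) \<in> borel_measurable borel"
    by (rule measurable_emeasure_section[OF _ joint]) simp
  have "{\<phi> \<in> space borel. \<phi> \<in> N0 \<and> 0 < emeasure (as_measure \<phi>) (Z \<phi>)} \<in> sets borel"
    by measurable
  ultimately show ?thesis by simp
qed

lemma measurable_point_map_translation:
  assumes f: "point_map f"
  shows "point_map_translation f \<in> N0_space \<rightarrow>\<^sub>M N0_space"
proof (rule measurable_restrict_space2)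
  show "point_map_translation f \<in> space N0_space \<rightarrow> N0"
    using f by (auto simp: point_map_translation_def point_map_def translate_in_N0_iff space_restrict_space)
  have "f \<in> borel_measurable N0_space" using f by (simp add: point_map_def)
  then have "(\<lambda>\<phi>. (f \<phi>, \<phi>)) \<in> N0_space \<rightarrow>\<^sub>M borel \<Otimes>\<^sub>M borel"
    by (intro measurable_Pair measurable_restrict_space1[OF measurable_ident_sets]) auto
  from measurable_compose[OF this measurable_translate]
  show "point_map_translation f \<in> N0_space \<rightarrow>\<^sub>M borel"
    by (simp add: point_map_translation_def[abs_def])
qed

section \<open>Singularity\<close>

lemma distr_funpow_invariant:
  assumes T: "T \<in> M \<rightarrow>\<^sub>M M" and Q: "sets Q = sets M" "Q = distr Q M T"
  shows "Q = distr Q M (T ^^ n)"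
proof (induction n)
  case 0
  show ?case using Q(1) by (simp add: distr_id2 id_def)
next
  case (Suc n)
  have T': "T \<in> Q \<rightarrow>\<^sub>M M" "T ^^ n \<in> Q \<rightarrow>\<^sub>M M"
    using T Q(1) measurable_compose_n[OF T] by (auto cong: measurable_cong_sets)
  have "distr Q M (T ^^ Suc n) = distr (distr Q M (T ^^ n)) M T"
    using T T' by (simp add: distr_distr)
  also have "\<dots> = Q" using Suc Q(2) by simp
  finally show ?case ..
qed

text \<open>
  An invariant \<open>Q\<close> is its own image under the \<open>n\<close>-fold translation, all of whose values lie in
  \<open>nth_images f n\<close>.
\<close>

lemma AE_nth_images:
  fixes Q :: "'a::euclidean_space counting_measure measure"
  assumes f: "point_map f" and Q: "sets Q = sets N0_space" "Q = distr Q N0_space (point_map_translation f)"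
  shows "AE \<phi> in Q. \<phi> \<in> nth_images f n"
proof -
  let ?T = "point_map_translation f ^^ n"
  have sp: "space Q = N0" using sets_eq_imp_space_eq[OF Q(1)] by (simp add: space_restrict_space)
  have T: "?T \<in> Q \<rightarrow>\<^sub>M N0_space"
    using measurable_compose_n[OF measurable_point_map_translation[OF f], of n] Q(1)
    by (auto cong: measurable_cong_sets)
  have "nth_images f n \<subseteq> N0" by (auto simp: nth_images_def)
  then have "nth_images f n \<in> sets N0_space"
    using sets_nth_images[OF f, of n] by (subst sets_restrict_space_iff) auto
  then have "{\<phi> \<in> space N0_space. \<phi> \<in> nth_images f n} \<in> sets N0_space"
    using \<open>nth_images f n \<subseteq> N0\<close>
    by (simp add: space_restrict_space Int_absorb1 Collect_conj_eq)
  then have "(AE \<phi> in distr Q N0_space ?T. \<phi> \<in> nth_images f n) \<longleftrightarrow> (AE \<phi> in Q. ?T \<phi> \<in> nth_images f n)"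
    by (rule AE_distr_iff[OF T])
  moreover have "AE \<phi> in Q. ?T \<phi> \<in> nth_images f n"
    by (rule AE_I2) (use point_map_translation_funpow_in_nth_images[OF f] sp in auto)
  ultimately show ?thesis
    using distr_funpow_invariant[OF measurable_point_map_translation[OF f] Q, of n] by metis
qed

text \<open>
  The Palm probability of \<open>\<Phi> \<in> A\<close> averages, over the points \<open>t\<close> of \<open>\<Phi>\<close> in \<open>B\<close>, the indicator that \<open>\<Phi>\<close> seen
  from \<open>t\<close> lies in \<open>A\<close>.
\<close>

lemma (in stationary_point_process) palm_distribution_null:
  assumes A: "A \<in> sets borel" "A \<subseteq> N0"
    and none: "AE \<omega> in P. \<forall>t\<in>points (\<Phi> \<omega>). translate t (\<Phi> \<omega>) \<notin> A"
  shows "emeasure (palm_distribution P \<theta> \<Phi> B) A = 0"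
proof -
  let ?A' = "\<Phi> -` A \<inter> space P"
  let ?\<mu> = "\<lambda>A. (\<integral>\<^sup>+\<omega>. (\<integral>\<^sup>+t. indicator B t * indicator A (\<theta> t \<omega>) \<partial>as_measure (\<Phi> \<omega>)) \<partial>P)
            / (intensity P \<Phi> * emeasure lborel B)"
  have "AE \<omega> in P. (\<integral>\<^sup>+t. indicator B t * indicator ?A' (\<theta> t \<omega>) \<partial>as_measure (\<Phi> \<omega>)) = 0"
    using none AE_space
  proof eventually_elim
    fix \<omega> assume \<omega>: "\<forall>t\<in>points (\<Phi> \<omega>). translate t (\<Phi> \<omega>) \<notin> A" "\<omega> \<in> space P"
    have "AE t in as_measure (\<Phi> \<omega>). indicator B t * indicator ?A' (\<theta> t \<omega>) = (0 :: ennreal)"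
      using AE_points[of "\<Phi> \<omega>"]
      by eventually_elim (use \<omega> process_compatible[of \<omega>] in \<open>auto simp: indicator_def\<close>)
    then have "(\<integral>\<^sup>+t. indicator B t * indicator ?A' (\<theta> t \<omega>) \<partial>as_measure (\<Phi> \<omega>))
        = (\<integral>\<^sup>+t. 0 \<partial>as_measure (\<Phi> \<omega>))"
      by (rule nn_integral_cong_AE)
    then show "(\<integral>\<^sup>+t. indicator B t * indicator ?A' (\<theta> t \<omega>) \<partial>as_measure (\<Phi> \<omega>)) = 0"
      by simp
  qed
  then have "(\<integral>\<^sup>+\<omega>. (\<integral>\<^sup>+t. indicator B t * indicator ?A' (\<theta> t \<omega>) \<partial>as_measure (\<Phi> \<omega>)) \<partial>P)
      = (\<integral>\<^sup>+\<omega>. 0 \<partial>P)"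
    by (rule nn_integral_cong_AE)
  then have "?\<mu> ?A' = 0" by simp
  \<comment> \<open>A measure built by \<open>measure_of\<close> gives a set either its prescribed value or zero, the latter if the
    prescription is not countably additive; here both are zero.\<close>
  then have "emeasure (palm_probability P \<theta> \<Phi> B) ?A' = 0"
    unfolding palm_probability_def emeasure_measure_of_conv by simp
  moreover have "space (palm_probability P \<theta> \<Phi> B) = space P"
    and sets: "sets (palm_probability P \<theta> \<Phi> B) = sets P"
    by (simp_all add: palm_probability_def)
  moreover have "\<Phi> \<in> palm_probability P \<theta> \<Phi> B \<rightarrow>\<^sub>M borel"
    using process_measurable by (simp add: measurable_cong_sets[OF sets refl])
  ultimately show ?thesis
    using A sets_N0 unfolding palm_distribution_def
    by (subst emeasure_restrict_space) (auto simp: emeasure_distr)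
qed

theorem theorem2p16:
  fixes P :: "'w measure"
    and \<theta> :: "'a::euclidean_space \<Rightarrow> 'w \<Rightarrow> 'w"
    and \<Phi> :: "'w \<Rightarrow> 'a counting_measure"
    and f :: "'a counting_measure \<Rightarrow> 'a"
    and B :: "'a set"
    and Q :: "'a counting_measure measure"
  assumes "stationary_point_process P \<theta> \<Phi>"
    and "AE \<omega> in P. simple_counting_measure (\<Phi> \<omega>)"
    and "0 < intensity P \<Phi>" and "intensity P \<Phi> < \<infinity>"
    and "point_map f"
    and "evaporates P \<Phi> f"
    and "B \<in> sets borel" and "0 < emeasure lborel B" and "emeasure lborel B < \<infinity>"
    and "is_f_probability f (palm_distribution P \<theta> \<Phi> B) Q"
    and "Q = distr Q N0_space (point_map_translation f)"
  shows "mutually_singular Q (palm_distribution P \<theta> \<Phi> B)"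
proof -
  interpret stationary_point_process P \<theta> \<Phi> by fact
  note f = \<open>point_map f\<close>
  let ?A = "\<Inter>n\<in>{1..}. nth_images f n"
  have Q: "sets Q = sets N0_space"
    using \<open>is_f_probability f _ Q\<close> by (simp add: is_f_probability_def weak_limit_N0_def M1_N0_def)
  have A: "?A \<in> sets borel" "?A \<subseteq> N0"
    using sets_nth_images[OF f] by (auto simp: nth_images_def)
  then have "?A \<in> sets N0_space" by (subst sets_restrict_space_iff) auto
  moreover have "sets (palm_distribution P \<theta> \<Phi> B) = sets N0_space"
    unfolding palm_distribution_def by (intro sets_restrict_space_cong) simp
  moreover have "AE \<phi> in Q. \<forall>n. \<phi> \<in> nth_images f n"
    unfolding AE_all_countable using AE_nth_images[OF f Q assms(11)] by (intro allI)
  then have "AE \<phi> in Q. \<phi> \<in> ?A" by eventually_elim blast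
  then have "emeasure Q (space Q - ?A) = 0"
    using emeasure_eq_0_AE[of "\<lambda>\<phi>. \<phi> \<notin> ?A" Q] by (simp only: set_diff_eq not_not)
  moreover have "AE \<omega> in P. \<forall>t\<in>points (\<Phi> \<omega>). translate t (\<Phi> \<omega>) \<notin> ?A"
    using \<open>evaporates P \<Phi> f\<close> unfolding evaporates_def
    by eventually_elim (auto simp: translate_in_nth_images_iff)
  then have "emeasure (palm_distribution P \<theta> \<Phi> B) ?A = 0"
    by (rule palm_distribution_null[OF A])
  ultimately show ?thesis
    unfolding mutually_singular_def using Q by (intro bexI[of _ ?A] conjI) simp_all
qed

end
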